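(* Let $X$ be a Tychonoff space and let $E$ be any set of functions with $L(X)\subseteq E\subseteq C(X_{\aleph_0})$, endowed with the topology of pointwise convergence. Then $s(E)=s^*(X_{\aleph_0})$.
   Context: All spaces are Tychonoff. A zero-set of $X$ is a set $\{x\in X: f(x)=0\}$ with $f:X\to\mathbb{R}$ continuous; $Z(X)$ is the family of all zero-sets of $X$. $X_{\aleph_0}$ is the set $X$ with the (Baire) topology having $Z(X)$ as a base. $C(X_{\aleph_0})$ is the set of all continuous real-valued functions on $X_{\aleph_0}$. $L(X)=\{n_1 f_{Z_1}+\dots+n_k f_{Z_k}: k\in\mathbb{N},\ n_i\in\mathbb{N},\ Z_i\in Z(X)\}$, where $f_Z$ is the characteristic function of $Z\subseteq X$. The topology of pointwise convergence on $E$ is the subspace topology from $\mathbb{R}^X$. $s(Y)$ is the spread of $Y$ (the supremum of cardinalities of discrete subspaces of $Y$), and $s^*(Y)=\sup\{s(Y^n): n\in\mathbb{N}\}$. As is standard, values of cardinal functions are taken to be infinite cardinals (at least $\omega_0$). *)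

theory Defs
  imports "HOL-Analysis.Analysis"
begin

unbundle cardinal_syntax
no_notation elt_set_eq (infix "=o" 50)  (* leaves =o for equality of cardinals *)

section \<open>Suprema of cardinals\<close>

text \<open>
  Cardinals are represented by card orders and compared by \<^const>\<open>ordLeq\<close> and
  \<^const>\<open>ordIso\<close>.  The supremum of a set of cardinals is a least cardinal upper bound.
  Looking for it on the type carrying the given card orders is no restriction: it exists
  there, and it lies below the upper bounds living on any other type
  (\<open>card_Sup_least\<close> below).
\<close>

definition is_card_sup :: "'b rel set \<Rightarrow> 'b rel \<Rightarrow> bool" where
  "is_card_sup R \<kappa> \<longleftrightarrow>
     Card_order \<kappa> \<and> (\<forall>r\<in>R. r \<le>o \<kappa>) \<and>
     (\<forall>\<mu>::'b rel. Card_order \<mu> \<and> (\<forall>r\<in>R. r \<le>o \<mu>) \<longrightarrow> \<kappa> \<le>o \<mu>)"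

definition card_Sup :: "'b rel set \<Rightarrow> 'b rel" where
  "card_Sup R = (SOME \<kappa>. is_card_sup R \<kappa>)"

lemma is_card_sup_card_Sup:
  fixes R :: "'b rel set"
  assumes "\<And>r. r \<in> R \<Longrightarrow> Card_order r"
  shows "is_card_sup R (card_Sup R)"
proof -
  let ?U = "{\<kappa>::'b rel. Card_order \<kappa> \<and> (\<forall>r\<in>R. r \<le>o \<kappa>)}"
  have "r \<le>o |UNIV :: 'b set|" if "r \<in> R" for r
  proof -
    have "r =o |Field r|"
      using assms[OF that] by (rule ordIso_symmetric[OF card_of_Field_ordIso])
    also have "|Field r| \<le>o |UNIV :: 'b set|"
      by (rule card_of_mono1[OF subset_UNIV])
    finally show ?thesis .
  qed
  then have "|UNIV :: 'b set| \<in> ?U"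
    by (simp add: card_of_Card_order)
  then have "\<exists>\<kappa>\<in>?U. \<forall>\<mu>\<in>?U. \<kappa> \<le>o \<mu>"
    by (intro exists_minim_Card_order) auto
  then have "\<exists>\<kappa>. is_card_sup R \<kappa>"
    by (auto simp: is_card_sup_def)
  then show ?thesis
    unfolding card_Sup_def by (rule someI_ex)
qed

lemma card_Sup_least:
  fixes R :: "'b rel set" and \<mu> :: "'c rel"
  assumes R: "\<And>r. r \<in> R \<Longrightarrow> Card_order r"
    and \<mu>: "Card_order \<mu>" "\<And>r. r \<in> R \<Longrightarrow> r \<le>o \<mu>"
  shows "card_Sup R \<le>o \<mu>"
proof (rule ccontr)
  have sup: "is_card_sup R (card_Sup R)"
    using R by (rule is_card_sup_card_Sup)
  assume "\<not> card_Sup R \<le>o \<mu>"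
  then have less: "\<mu> <o card_Sup R"
    using sup \<mu>(1) unfolding is_card_sup_def card_order_on_def
    by (simp add: not_ordLeq_iff_ordLess)
  then have "\<mu> \<le>o card_Sup R"
    by (rule ordLess_imp_ordLeq)
  then obtain p :: "'b rel" where p: "\<mu> =o p"
    using iffD1[OF internalize_ordLeq] by metis
  then have "Card_order p"
    by (rule Card_order_ordIso2[OF \<mu>(1)])
  moreover have "\<forall>r\<in>R. r \<le>o p"
    using ordLeq_ordIso_trans[OF \<mu>(2) p] by simp
  ultimately have "card_Sup R \<le>o p"
    using sup by (simp add: is_card_sup_def)
  then have "card_Sup R \<le>o \<mu>"
    by (rule ordLeq_ordIso_trans[OF _ ordIso_symmetric[OF p]])
  with \<open>\<not> card_Sup R \<le>o \<mu>\<close> show False ..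
qed

section \<open>Spread\<close>

text \<open>
  Adding \<^const>\<open>natLeq\<close> replaces a finite cardinality by the first infinite cardinal and
  does not change an infinite one, so cardinal functions take infinite values only.
\<close>

definition spread :: "'a topology \<Rightarrow> ('a + nat) rel" where
  "spread Y = card_Sup {|D| +c natLeq | D.
     D \<subseteq> topspace Y \<and> subtopology Y D = discrete_topology D}"

text \<open>
  The exponent \<open>0\<close> is harmless: a one-point space has the least possible spread.
\<close>

definition spread_star :: "'a topology \<Rightarrow> ((nat \<Rightarrow> 'a) + nat) rel" where
  "spread_star Y = card_Sup (range (\<lambda>n. spread (product_topology (\<lambda>_. Y) {..<n})))"

section \<open>Zero-sets, the Baire topology and function spaces\<close>

definition tychonoff_space :: "'a topology \<Rightarrow> bool" where
  "tychonoff_space X \<longleftrightarrow> completely_regular_space X \<and> t1_space X"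

definition zero_sets :: "'a topology \<Rightarrow> 'a set set" where
  "zero_sets X = {{x \<in> topspace X. f x = 0} | f. continuous_map X euclideanreal f}"

definition baire_topology :: "'a topology \<Rightarrow> 'a topology" where
  "baire_topology X = topology (arbitrary union_of (\<lambda>Z. Z \<in> zero_sets X))"

lemma zero_setsI:
  "continuous_map X euclideanreal f \<Longrightarrow> {x \<in> topspace X. f x = 0} \<in> zero_sets X"
  by (auto simp: zero_sets_def)

lemma zero_sets_Int:
  assumes "S \<in> zero_sets X" "T \<in> zero_sets X"
  shows "S \<inter> T \<in> zero_sets X"
proof -
  obtain f g where fg: "continuous_map X euclideanreal f" "continuous_map X euclideanreal g"
    and S: "S = {x \<in> topspace X. f x = 0}" and T: "T = {x \<in> topspace X. g x = 0}"
    using assms unfolding zero_sets_def by auto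
  have "{x \<in> topspace X. \<bar>f x\<bar> + \<bar>g x\<bar> = 0} \<in> zero_sets X"
    by (intro zero_setsI continuous_intros fg)
  moreover have "S \<inter> T = {x \<in> topspace X. \<bar>f x\<bar> + \<bar>g x\<bar> = 0}"
    unfolding S T by (auto simp: add_nonneg_eq_0_iff)
  ultimately show ?thesis
    by simp
qed

lemma openin_baire_topology:
  "openin (baire_topology X) = arbitrary union_of (\<lambda>Z. Z \<in> zero_sets X)"
  unfolding baire_topology_def
  by (intro topology_inverse' istopology_base zero_sets_Int)

lemma topspace_baire_topology [simp]: "topspace (baire_topology X) = topspace X"
proof
  obtain \<U> where "\<U> \<subseteq> zero_sets X" "\<Union>\<U> = topspace (baire_topology X)"
    using openin_topspace[of "baire_topology X"]
    unfolding openin_baire_topology union_of_def arbitrary_def by auto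
  then show "topspace (baire_topology X) \<subseteq> topspace X"
    by (fastforce simp: zero_sets_def)
  have "topspace X \<in> zero_sets X"
    using zero_setsI[of X "\<lambda>_. 0"] by simp
  then have "openin (baire_topology X) (topspace X)"
    unfolding openin_baire_topology by (simp add: arbitrary_union_of_inc)
  then show "topspace X \<subseteq> topspace (baire_topology X)"
    by (rule openin_subset)
qed

text \<open>
  Functions on a space are normalised to be \<^const>\<open>extensional\<close>, so that they are exactly
  the points of the product \<^term>\<open>product_topology (\<lambda>_. euclideanreal) (topspace X)\<close>.
\<close>

definition cont_functions :: "'a topology \<Rightarrow> ('a \<Rightarrow> real) set" where
  "cont_functions Y = {f \<in> extensional (topspace Y). continuous_map Y euclideanreal f}"

text \<open>
  Whether zero is allowed for the number of summands and for the coefficients is immaterial: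
  the zero function is the characteristic function of the zero-set \<open>{}\<close>.
\<close>

definition L_functions :: "'a topology \<Rightarrow> ('a \<Rightarrow> real) set" where
  "L_functions X =
     {(\<lambda>x\<in>topspace X. \<Sum>i<k. real (n i) * indicat_real (Z i) x) | (k::nat) n Z.
        \<forall>i<k. Z i \<in> zero_sets X}"

definition pointwise_topology :: "'a topology \<Rightarrow> ('a \<Rightarrow> real) set \<Rightarrow> ('a \<Rightarrow> real) topology" where
  "pointwise_topology X E =
     subtopology (product_topology (\<lambda>_. euclideanreal) (topspace X)) E"

end

theory Submission
  imports Defs "HOL-Library.Countable_Set_Type"
begin

text \<open>
  Write \<open>Y\<close> for the Baire topology of \<open>X\<close>.  Functions and finite tuples of points play
  symmetric roles: a basic neighbourhood of a function \<open>f\<close> is given by finitely many points,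
  that is, by a point of a finite power of \<open>Y\<close>, with an open set of reals for each of them,
  and a neighbourhood of a tuple is given
  by finitely many sets, which a single function can encode.  Both inequalities turn a discrete
  family on one side into a discrete family on the other side, indexed by the same set
  (\<open>card_of_le_spread\<close>).

  For \<open>s(E) \<le> s\<^sup>*(Y)\<close>, let \<open>D\<close> be a discrete set of continuous functions.  Each \<open>f \<in> D\<close> is
  isolated in \<open>D\<close> by conditions \<open>f (x\<^sub>i) \<in> B\<^sub>i\<close> for \<open>i < n\<close>, with \<open>B\<^sub>i\<close> in a countable base of
  the real line.  There are only countably many lists of basic sets, so it is enough to bound
  the number of those \<open>f\<close> that share one list.  The tuples \<open>x\<^sub>f\<close> of these functions are discrete
  in the power \<open>Y\<^sup>n\<close>, separated by the open boxes \<open>{y. \<forall>i. f (y\<^sub>i) \<in> B\<^sub>i}\<close>: if the box of \<open>f\<close>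
  contains \<open>x\<^sub>g\<close>, then \<open>f\<close> satisfies the conditions isolating \<open>g\<close>.

  For \<open>s\<^sup>*(Y) \<le> s(E)\<close>, let \<open>D\<close> be a discrete subset of \<open>Y\<^sup>n\<close>, and isolate each \<open>y \<in> D\<close> by a box
  with zero-sets \<open>Z\<^sub>i\<^sup>y\<close> as sides.  The linear combination of the characteristic functions of
  these sides with coefficients \<open>2\<^sup>i\<close> lies in \<open>L(X)\<close>, and its value at a point tells, through
  binary digits, which of the sets \<open>Z\<^sub>i\<^sup>y\<close> contain the point.  If the functions of \<open>y\<close> and \<open>z\<close> agree at
  all coordinates of \<open>y\<close>, then \<open>y\<^sub>i \<in> Z\<^sub>i\<^sup>z\<close> for each \<open>i\<close> because \<open>y\<^sub>i \<in> Z\<^sub>i\<^sup>y\<close>; hence \<open>y = z\<close>.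
  The values being integers, closeness at these finitely many points already forces agreement.
\<close>

section \<open>Spread and separated families\<close>

lemma Card_order_spread: "Card_order (spread Y)"
  and card_csum_natLeq_le_spread:
    "\<lbrakk>D \<subseteq> topspace Y; subtopology Y D = discrete_topology D\<rbrakk> \<Longrightarrow> |D| +c natLeq \<le>o spread Y"
proof -
  let ?R = "{|D| +c natLeq | D. D \<subseteq> topspace Y \<and> subtopology Y D = discrete_topology D}"
  have *: "is_card_sup ?R (spread Y)"
    unfolding spread_def by (rule is_card_sup_card_Sup) (auto simp: Card_order_csum)
  then show "Card_order (spread Y)"
    by (simp add: is_card_sup_def)
  show "|D| +c natLeq \<le>o spread Y"
    if "D \<subseteq> topspace Y" "subtopology Y D = discrete_topology D"
    using * that unfolding is_card_sup_def by blast
qed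

lemma natLeq_le_spread:
  fixes Y :: "'a topology"
  shows "natLeq \<le>o spread Y"
proof -
  have "subtopology Y {} = discrete_topology {}"
    by (subst subtopology_eq_discrete_topology_empty) simp
  then have "|{} :: 'a set| +c natLeq \<le>o spread Y"
    by (rule card_csum_natLeq_le_spread[OF empty_subsetI])
  then show ?thesis
    by (rule ordLeq_transitive[OF ordLeq_csum2[OF natLeq_Card_order]])
qed

lemma spread_le:
  assumes "Card_order \<mu>" "natLeq \<le>o \<mu>"
    and "\<And>D. \<lbrakk>D \<subseteq> topspace Y; subtopology Y D = discrete_topology D\<rbrakk> \<Longrightarrow> |D| \<le>o \<mu>"
  shows "spread Y \<le>o \<mu>"
  unfolding spread_def
proof (rule card_Sup_least)
  have "cinfinite \<mu>"
    using assms(2) natLeq_cinfinite by (rule cinfinite_mono)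
  then show "r \<le>o \<mu>"
    if "r \<in> {|D| +c natLeq | D. D \<subseteq> topspace Y \<and> subtopology Y D = discrete_topology D}" for r
    using that assms
    by (auto intro!: csum_cinfinite_bound simp: natLeq_Card_order card_of_Card_order)
qed (use assms in \<open>auto simp: Card_order_csum\<close>)

lemma discrete_subspace_separated:
  assumes "subtopology Y D = discrete_topology D" "x \<in> D"
  obtains U where "openin Y U" "U \<inter> D = {x}"
proof -
  have "openin (subtopology Y D) {x}"
    using assms by simp
  then show ?thesis
    using that unfolding openin_subtopology by metis
qed

text \<open>
  The separating condition makes \<open>p\<close> injective on \<open>I\<close> and its image discrete.
\<close>

lemma card_of_le_spread:
  assumes sep: "\<And>i. i \<in> I \<Longrightarrow> \<exists>U. openin Y U \<and> p i \<in> U \<and> (\<forall>j\<in>I. p j \<in> U \<longrightarrow> j = i)"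
  shows "|I| \<le>o spread Y"
proof -
  have inj: "inj_on p I"
    unfolding inj_on_def using sep by metis
  have sub: "p ` I \<subseteq> topspace Y"
    using sep openin_subset by blast
  have "openin (subtopology Y (p ` I)) {p i}" if i: "i \<in> I" for i
  proof -
    obtain U where "openin Y U" "p i \<in> U" "\<forall>j\<in>I. p j \<in> U \<longrightarrow> j = i"
      using sep[OF i] by blast
    then have "openin Y U \<and> {p i} = U \<inter> p ` I"
      using i by blast
    then show ?thesis
      unfolding openin_subtopology by blast
  qed
  then have "discrete_topology (p ` I) = subtopology Y (p ` I)"
    using sub by (subst discrete_topology_unique) auto
  then have "|p ` I| +c natLeq \<le>o spread Y"
    using sub by (intro card_csum_natLeq_le_spread) auto
  moreover have "|I| =o |p ` I|"
    using inj card_of_ordIso bij_betw_imageI by blast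
  moreover have "|p ` I| \<le>o |p ` I| +c natLeq"
    by (rule ordLeq_csum1[OF card_of_Card_order])
  ultimately show ?thesis
    using ordIso_ordLeq_trans ordLeq_transitive by blast
qed

lemma Card_order_spread_star: "Card_order (spread_star Y)"
  and spread_power_le_spread_star:
    "spread (product_topology (\<lambda>_. Y) {..<n::nat}) \<le>o spread_star Y"
proof -
  have *: "is_card_sup (range (\<lambda>n::nat. spread (product_topology (\<lambda>_. Y) {..<n}))) (spread_star Y)"
    unfolding spread_star_def by (rule is_card_sup_card_Sup) (auto simp: Card_order_spread)
  show "Card_order (spread_star Y)"
    and "spread (product_topology (\<lambda>_. Y) {..<n}) \<le>o spread_star Y"
    using * by (simp_all add: is_card_sup_def)
qed

lemma natLeq_le_spread_star: "natLeq \<le>o spread_star Y"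
  using natLeq_le_spread spread_power_le_spread_star by (rule ordLeq_transitive)

section \<open>The topology of pointwise convergence\<close>

lemma openin_pointwise_topology_finite:
  fixes V :: "nat \<Rightarrow> real set"
  assumes "\<And>i. i < n \<Longrightarrow> x i \<in> topspace X" "\<And>i. i < n \<Longrightarrow> open (V i)"
  shows "openin (pointwise_topology X E)
           {h \<in> topspace (pointwise_topology X E). \<forall>i<n. h (x i) \<in> V i}"
  using assms
proof (induction n)
  case (Suc n)
  let ?P = "pointwise_topology X E"
  have "continuous_map ?P euclideanreal (\<lambda>h. h (x n))"
    unfolding pointwise_topology_def
    by (intro continuous_map_from_subtopology continuous_map_product_projection) (use Suc in auto)
  then have "openin ?P {h \<in> topspace ?P. h (x n) \<in> V n}"
    by (rule openin_continuous_map_preimage) (use Suc in auto)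
  moreover have "openin ?P {h \<in> topspace ?P. \<forall>i<n. h (x i) \<in> V i}"
    using Suc by auto
  moreover have "{h \<in> topspace ?P. \<forall>i<Suc n. h (x i) \<in> V i} =
      {h \<in> topspace ?P. h (x n) \<in> V n} \<inter> {h \<in> topspace ?P. \<forall>i<n. h (x i) \<in> V i}"
    by (auto simp: less_Suc_eq)
  ultimately show ?case
    by (simp add: openin_Int)
qed auto

text \<open>
  The coordinates restricted by a basic open set are enumerated by an initial segment of the
  natural numbers.  The test points then form an element of a finite power of the space, and
  the sets form an element of a countable set when the base is countable.
\<close>

lemma pointwise_topology_basic_neighbourhood:
  assumes B: "topological_basis B"
    and U: "openin (pointwise_topology X E) U" "f \<in> U"
  obtains l x where "l \<in> lists B" "x \<in> {..<length l} \<rightarrow>\<^sub>E topspace X"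
    and "\<And>i. i < length l \<Longrightarrow> f (x i) \<in> l ! i"
    and "\<And>g. \<lbrakk>g \<in> topspace (pointwise_topology X E); \<And>i. i < length l \<Longrightarrow> g (x i) \<in> l ! i\<rbrakk>
           \<Longrightarrow> g \<in> U"
proof -
  let ?P = "product_topology (\<lambda>_. euclideanreal) (topspace X)"
  obtain T where T: "openin ?P T" "U = T \<inter> E"
    using U(1) unfolding pointwise_topology_def openin_subtopology by auto
  then obtain W where W: "finite {x \<in> topspace X. W x \<noteq> UNIV}" "\<And>x. x \<in> topspace X \<Longrightarrow> open (W x)"
      "f \<in> Pi\<^sub>E (topspace X) W" "Pi\<^sub>E (topspace X) W \<subseteq> T"
    using U(2) unfolding openin_product_topology_alt by fastforce
  obtain xs where xs: "set xs = {x \<in> topspace X. W x \<noteq> UNIV}"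
    using finite_list[OF W(1)] by blast
  have "\<exists>b\<in>B. f x \<in> b \<and> b \<subseteq> W x" if "x \<in> topspace X" for x
    using topological_basisE[OF B W(2)[OF that]] W(3) that by (metis PiE_mem)
  then obtain b where b: "\<And>x. x \<in> topspace X \<Longrightarrow> b x \<in> B \<and> f x \<in> b x \<and> b x \<subseteq> W x"
    by metis
  have xs_top: "xs ! i \<in> topspace X" if "i < length xs" for i
    using nth_mem[OF that] xs by auto
  show ?thesis
  proof (rule that[of "map b xs" "\<lambda>i\<in>{..<length xs}. xs ! i"])
    show "map b xs \<in> lists B"
      using b xs by auto
    fix g
    assume g: "g \<in> topspace (pointwise_topology X E)"
      and gb: "\<And>i. i < length (map b xs) \<Longrightarrow>
              g ((\<lambda>i\<in>{..<length xs}. xs ! i) i) \<in> map b xs ! i"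
    have gE: "g \<in> E" "g \<in> extensional (topspace X)"
      using g by (auto simp: pointwise_topology_def PiE_def)
    have "g x \<in> W x" if x: "x \<in> topspace X" for x
    proof (cases "W x = UNIV")
      case False
      then obtain i where "i < length xs" "x = xs ! i"
        using x xs by (metis (mono_tags, lifting) in_set_conv_nth mem_Collect_eq)
      then show ?thesis
        using gb[of i] b[OF x] by auto
    qed auto
    then show "g \<in> U"
      using gE W(4) T(2) by (auto simp: PiE_def)
  qed (use xs_top b in auto)
qed

section \<open>The two inequalities\<close>

text \<open>
  Functions isolated by the same list of sets differ only in the points at which they are
  tested, and continuity makes these testing tuples a discrete set.
\<close>

lemma spread_cont_functions_le:
  assumes "topspace Y = topspace X" and E: "E \<subseteq> cont_functions Y"
  shows "spread (pointwise_topology X E) \<le>o spread_star Y"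
proof (rule spread_le[OF Card_order_spread_star natLeq_le_spread_star])
  fix D
  assume D: "D \<subseteq> topspace (pointwise_topology X E)"
    and disc: "subtopology (pointwise_topology X E) D = discrete_topology D"
  obtain B :: "real set set" where B: "countable B" "topological_basis B"
    using ex_countable_basis by blast
  \<comment> \<open>Countability of \<open>B\<close> keeps the lists of tests countable: splitting \<open>D\<close> by list is then
     free of charge, since spreads are infinite cardinals.\<close>
  define isolates where "isolates l f x \<longleftrightarrow>
      x \<in> {..<length l} \<rightarrow>\<^sub>E topspace X \<and> (\<forall>i<length l. f (x i) \<in> l ! i) \<and>
      (\<forall>g\<in>D. (\<forall>i<length l. g (x i) \<in> l ! i) \<longrightarrow> g = f)" for l :: "real set list" and f x
  define D' where "D' l = {f \<in> D. \<exists>x. isolates l f x}" for l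
  have "\<exists>l\<in>lists B. \<exists>x. isolates l f x" if f: "f \<in> D" for f
  proof -
    obtain U where U: "openin (pointwise_topology X E) U" "U \<inter> D = {f}"
      using discrete_subspace_separated[OF disc f] .
    then have "f \<in> U"
      by blast
    obtain l x where lx: "l \<in> lists B" "x \<in> {..<length l} \<rightarrow>\<^sub>E topspace X"
        "\<And>i. i < length l \<Longrightarrow> f (x i) \<in> l ! i"
        "\<And>g. \<lbrakk>g \<in> topspace (pointwise_topology X E); \<And>i. i < length l \<Longrightarrow> g (x i) \<in> l ! i\<rbrakk>
           \<Longrightarrow> g \<in> U"
      using pointwise_topology_basic_neighbourhood[OF B(2) U(1) \<open>f \<in> U\<close>] by metis
    then have "isolates l f x"
      unfolding isolates_def using U(2) D by blast
    then show ?thesis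
      using lx(1) by blast
  qed
  then have D_eq: "D = (\<Union>l\<in>lists B. D' l)"
    unfolding D'_def by auto
  have "|D' l| \<le>o spread_star Y" if "l \<in> lists B" for l
  proof -
    let ?n = "length l"
    have "\<forall>f\<in>D' l. \<exists>x. isolates l f x"
      by (simp add: D'_def)
    then obtain p where p: "\<And>f. f \<in> D' l \<Longrightarrow> isolates l f (p f)"
      by metis
    have l_open: "open (l ! i)" if "i < ?n" for i
      using \<open>l \<in> lists B\<close> topological_basis_open[OF B(2)] nth_mem[OF that]
      by (auto simp: in_lists_conv_set)
    have "|D' l| \<le>o spread (product_topology (\<lambda>_. Y) {..<?n})"
    proof (rule card_of_le_spread[where p = p])
      fix f assume f: "f \<in> D' l"
      let ?U = "\<Pi>\<^sub>E i\<in>{..<?n}. {y \<in> topspace Y. f y \<in> l ! i}"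
      have "f \<in> cont_functions Y"
        using f D E by (auto simp: D'_def pointwise_topology_def)
      then have "openin Y {y \<in> topspace Y. f y \<in> l ! i}" if "i < ?n" for i
        using l_open[OF that] by (auto simp: cont_functions_def intro: openin_continuous_map_preimage)
      then have "openin (product_topology (\<lambda>_. Y) {..<?n}) ?U"
        by (simp add: openin_PiE)
      moreover have "p f \<in> ?U"
        using p[OF f] assms(1) by (auto simp: isolates_def PiE_iff)
      moreover have "g = f" if g: "g \<in> D' l" and "p g \<in> ?U" for g
      proof -
        have "\<forall>i<?n. f (p g i) \<in> l ! i"
          using \<open>p g \<in> ?U\<close> by (simp add: PiE_iff)
        moreover have "f \<in> D"
          using f by (simp add: D'_def)
        \<comment> \<open>The tests at \<open>p g\<close> use the list common to \<open>f\<close> and \<open>g\<close>, and among the functions in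
           \<open>D\<close> only \<open>g\<close> passes them.\<close>
        ultimately have "f = g"
          using p[OF g] unfolding isolates_def by blast
        then show ?thesis ..
      qed
      ultimately show "\<exists>U. openin (product_topology (\<lambda>_. Y) {..<?n}) U \<and> p f \<in> U \<and>
          (\<forall>g\<in>D' l. p g \<in> U \<longrightarrow> g = f)"
        by blast
    qed
    then show ?thesis
      using spread_power_le_spread_star by (rule ordLeq_transitive)
  qed
  moreover have "|lists B| \<le>o spread_star Y"
    using B(1) natLeq_le_spread_star
    by (meson countable_card_le_natLeq countable_lists ordLeq_transitive)
  moreover have "infinite (Field (spread_star Y))"
    using cinfinite_mono[OF natLeq_le_spread_star natLeq_cinfinite] by (simp add: cinfinite_def)
  ultimately show "|D| \<le>o spread_star Y"
    unfolding D_eq by (intro card_of_UNION_ordLeq_infinite_Field Card_order_spread_star) auto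
qed

text \<open>
  The powers of two record in a single number which sides of a box a point lies in.  This
  handles tuples with repeated entries and boxes with overlapping sides, for which a sum of the
  characteristic functions without weights would lose the order of the coordinates.
\<close>

lemma spread_star_baire_le:
  assumes L: "L_functions X \<subseteq> E"
  shows "spread_star (baire_topology X) \<le>o spread (pointwise_topology X E)"
proof -
  let ?P = "pointwise_topology X E"
  have "spread (product_topology (\<lambda>_. baire_topology X) {..<n}) \<le>o spread ?P" for n :: nat
  proof (rule spread_le[OF Card_order_spread natLeq_le_spread])
    let ?Q = "product_topology (\<lambda>_. baire_topology X) {..<n}"
    fix D
    assume D: "D \<subseteq> topspace ?Q" and disc: "subtopology ?Q D = discrete_topology D"
    have y_top: "y i \<in> topspace X" if y: "y \<in> D" "i < n" for y i
    proof -
      have "y \<in> topspace ?Q"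
        using y(1) D by blast
      then show ?thesis
        using y(2) by (simp add: PiE_iff)
    qed
    have "\<exists>Z. (\<forall>i<n. Z i \<in> zero_sets X \<and> y i \<in> Z i) \<and> (\<forall>z\<in>D. (\<forall>i<n. z i \<in> Z i) \<longrightarrow> z = y)"
      if y: "y \<in> D" for y
    proof -
      obtain U where U: "openin ?Q U" "U \<inter> D = {y}"
        using discrete_subspace_separated[OF disc y] .
      then have "y \<in> U"
        by blast
      with U(1) have "\<exists>W. (\<forall>i\<in>{..<n}. openin (baire_topology X) (W i)) \<and>
          y \<in> Pi\<^sub>E {..<n} W \<and> Pi\<^sub>E {..<n} W \<subseteq> U"
        unfolding openin_product_topology_alt by blast
      then obtain W where W: "\<And>i. i < n \<Longrightarrow> openin (baire_topology X) (W i)"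
          "y \<in> Pi\<^sub>E {..<n} W" "Pi\<^sub>E {..<n} W \<subseteq> U"
        by auto
      have "\<exists>Z\<in>zero_sets X. y i \<in> Z \<and> Z \<subseteq> W i" if "i < n" for i
      proof -
        have "y i \<in> W i"
          using W(2) that by auto
        with W(1)[OF that] show ?thesis
          unfolding openin_baire_topology arbitrary_union_of_alt by blast
      qed
      then obtain Z where Z: "\<And>i. i < n \<Longrightarrow> Z i \<in> zero_sets X \<and> y i \<in> Z i \<and> Z i \<subseteq> W i"
        by metis
      have "z = y" if "z \<in> D" "\<forall>i<n. z i \<in> Z i" for z
      proof -
        have "z \<in> topspace ?Q"
          using that(1) D by blast
        then have "z \<in> extensional {..<n}"
          by (simp add: PiE_iff)
        moreover have "\<forall>i<n. z i \<in> W i"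
          using Z that(2) by blast
        ultimately have "z \<in> Pi\<^sub>E {..<n} W"
          by (simp add: PiE_iff)
        then show ?thesis
          using W(3) U(2) that(1) by blast
      qed
      then show ?thesis
        using Z by blast
    qed
    then obtain Z where Z: "\<And>y i. \<lbrakk>y \<in> D; i < n\<rbrakk> \<Longrightarrow> Z y i \<in> zero_sets X \<and> y i \<in> Z y i"
      and Z_sep: "\<And>y z. \<lbrakk>y \<in> D; z \<in> D; \<And>i. i < n \<Longrightarrow> z i \<in> Z y i\<rbrakk> \<Longrightarrow> z = y"
      by metis
    define code where
      "code y = (\<lambda>x\<in>topspace X. \<Sum>i<n. real (2 ^ i) * indicat_real (Z y i) x)" for y
    have code_eq: "code y x = real (set_encode {i. i < n \<and> x \<in> Z y i})"
      if "x \<in> topspace X" for y x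
    proof -
      have "(\<Sum>i<n. real (2 ^ i) * indicat_real (Z y i) x) =
          (\<Sum>i<n. if x \<in> Z y i then real (2 ^ i) else 0)"
        by (intro sum.cong) (auto simp: indicator_def)
      also have "\<dots> = real (\<Sum>i | i < n \<and> x \<in> Z y i. 2 ^ i)"
        by (simp add: sum.If_cases Int_def)
      finally show ?thesis
        using that by (simp add: code_def set_encode_def)
    qed
    have code_top: "code y \<in> topspace ?P" if "y \<in> D" for y
    proof -
      have "code y \<in> L_functions X"
        unfolding L_functions_def code_def using Z[OF that] by blast
      moreover have "code y \<in> extensional (topspace X)"
        by (simp add: code_def)
      ultimately show ?thesis
        using L by (auto simp: pointwise_topology_def PiE_def)
    qed
    show "|D| \<le>o spread ?P"
    proof (rule card_of_le_spread[where p = code])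
      fix y assume y: "y \<in> D"
      \<comment> \<open>Radius \<open>1\<close> suffices, because codes take integer values.\<close>
      let ?U = "{h \<in> topspace ?P. \<forall>i<n. h (y i) \<in> ball (code y (y i)) 1}"
      have "openin ?P ?U"
        using y_top[OF y] by (intro openin_pointwise_topology_finite) auto
      moreover have "code y \<in> ?U"
        using code_top[OF y] by simp
      moreover have "z = y" if z: "z \<in> D" and zU: "code z \<in> ?U" for z
      proof -
        have "y i \<in> Z z i" if i: "i < n" for i
        proof -
          let ?S = "\<lambda>z. {j. j < n \<and> y i \<in> Z z j}"
          have "\<bar>real (set_encode (?S y)) - real (set_encode (?S z))\<bar> < 1"
            using zU i y_top[OF y i] by (auto simp: code_eq dist_real_def)
          \<comment> \<open>Agreement at \<open>y i\<close> means that \<open>y i\<close> lies in the same sides of both boxes; one of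
             them is side \<open>i\<close> of the box around \<open>y\<close>.\<close>
          then have "set_encode (?S y) = set_encode (?S z)"
            by linarith
          then have "?S y = ?S z"
            by (subst (asm) set_encode_eq) auto
          then show ?thesis
            using Z[OF y i] i by blast
        qed
        then show ?thesis
          using Z_sep[OF z y] by auto
      qed
      ultimately show "\<exists>U. openin ?P U \<and> code y \<in> U \<and> (\<forall>z\<in>D. code z \<in> U \<longrightarrow> z = y)"
        by blast
    qed
  qed
  then show ?thesis
    unfolding spread_star_def
    by (intro card_Sup_least) (auto simp: Card_order_spread)
qed

theorem theorem5p2:
  fixes X :: "'a topology" and E :: "('a \<Rightarrow> real) set"
  assumes "tychonoff_space X"
    and "L_functions X \<subseteq> E"
    and "E \<subseteq> cont_functions (baire_topology X)"
  shows "spread (pointwise_topology X E) =o spread_star (baire_topology X)"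
  using spread_cont_functions_le[OF topspace_baire_topology assms(3)]
    spread_star_baire_le[OF assms(2)]
  by (simp add: ordIso_iff_ordLeq)

end
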